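(* Let $(M,F)$ be a non-Riemannian $m$-th root Finsler manifold with mean Cartan torsion $\mathbf{I}$ and mean Landsberg curvature $\mathbf{J}$. For a scalar function $c=c(x)$ on $M$, the following are equivalent: (ia) $\mathbf{J}+cF\mathbf{I}=0$; (ib) $\mathbf{J}=0$.
   Context: A Finsler metric on a manifold $M$ is a function $F:TM\to[0,\infty)$ that is $C^\infty$ on $TM_0=TM\setminus\{0\}$, positively $1$-homogeneous on the fibers of $TM$, and such that $g_{ij}(x,y)=\frac12\frac{\partial^2F^2}{\partial y^i\partial y^j}$ is positive definite for all $y\neq0$; $(g^{ij})$ denotes the inverse matrix of $(g_{ij})$. It is an $m$-th root Finsler metric if $F=\sqrt[m]{A}$, where in local coordinates $(x^i,y^i)$ on $TM$, $A=a_{i_1\dots i_m}(x)y^{i_1}\cdots y^{i_m}$ with $a_{i_1\dots i_m}$ symmetric in all its indices. Cartan torsion: $C_{ijk}=\frac12\frac{\partial g_{ij}}{\partial y^k}$; mean Cartan torsion $\mathbf{I}$: $I_i=g^{jk}C_{ijk}$. Spray coefficients: $G^i=\frac14 g^{il}\big[\frac{\partial^2F^2}{\partial x^k\partial y^l}y^k-\frac{\partial F^2}{\partial x^l}\big]$. Landsberg curvature (the rate of change of the Cartan torsion along Finslerian geodesics): $L_{ijk}=-\frac12 y_s\frac{\partial^3G^s}{\partial y^i\partial y^j\partial y^k}$ with $y_s=g_{st}y^t$; mean Landsberg curvature $\mathbf{J}$: $J_i=g^{jk}L_{ijk}$. $F$ is Riemannian if and only if $C_{ijk}=0$ identically.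
   Formalization: Condition (ia) is read as "J + cFI = 0 for some scalar function c(x)": for a fixed c, (ib) does not imply (ia), e.g. for a non-Riemannian locally Minkowskian quartic-root metric with c = 1, where J = 0 but FI is nonzero. *)

theory Defs
  imports "HOL-Analysis.Analysis"
begin

section \<open>Smooth functions on open subsets of Euclidean spaces\<close>

text \<open>\<open>higher_differentiable_on S f k\<close> is the property \<open>C\<^sup>k\<close> on an open set \<open>S\<close>: iterated directional
  derivatives up to order \<open>k\<close> exist as Frechet derivatives and are continuous.\<close>

primrec higher_differentiable_on ::
    "'a::real_normed_vector set \<Rightarrow> ('a \<Rightarrow> 'b::real_normed_vector) \<Rightarrow> nat \<Rightarrow> bool" where
  "higher_differentiable_on S f 0 \<longleftrightarrow> continuous_on S f"
| "higher_differentiable_on S f (Suc k) \<longleftrightarrow>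
     (\<forall>x\<in>S. f differentiable (at x)) \<and>
     (\<forall>v. higher_differentiable_on S (\<lambda>x. frechet_derivative f (at x) v) k)"

definition smooth_on :: "'a::real_normed_vector set \<Rightarrow> ('a \<Rightarrow> 'b::real_normed_vector) \<Rightarrow> bool" where
  "smooth_on S f \<longleftrightarrow> (\<forall>k. higher_differentiable_on S f k)"

section \<open>Smooth manifolds and their tangent bundles\<close>

text \<open>A chart is a pair of a domain and a coordinate map (only the values of the map on the domain
  matter). The dimension of the manifold is \<open>CARD('n)\<close>.\<close>

type_synonym ('a, 'n) chart = "'a set \<times> ('a \<Rightarrow> real ^ 'n)"

definition chart_image :: "('a, 'n::finite) chart \<Rightarrow> (real ^ 'n) set" where
  "chart_image \<kappa> = snd \<kappa> ` fst \<kappa>"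

definition chart_inv :: "('a, 'n::finite) chart \<Rightarrow> real ^ 'n \<Rightarrow> 'a" where
  "chart_inv \<kappa> = inv_into (fst \<kappa>) (snd \<kappa>)"

definition transition ::
    "('a, 'n::finite) chart \<Rightarrow> ('a, 'n) chart \<Rightarrow> real ^ 'n \<Rightarrow> real ^ 'n" where
  "transition \<kappa> \<mu> = snd \<mu> \<circ> chart_inv \<kappa>"

definition smooth_manifold :: "'a topology \<Rightarrow> ('a, 'n::finite) chart set \<Rightarrow> bool" where
  "smooth_manifold X \<A> \<longleftrightarrow>
     Hausdorff_space X \<and>
     (\<exists>\<B>. countable \<B> \<and> (\<forall>V\<in>\<B>. openin X V) \<and>
           (\<forall>U p. openin X U \<and> p \<in> U \<longrightarrow> (\<exists>V\<in>\<B>. p \<in> V \<and> V \<subseteq> U))) \<and>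
     (\<Union>\<kappa>\<in>\<A>. fst \<kappa>) = topspace X \<and>
     (\<forall>\<kappa>\<in>\<A>. openin X (fst \<kappa>) \<and> open (chart_image \<kappa>) \<and>
        homeomorphic_map (subtopology X (fst \<kappa>)) (top_of_set (chart_image \<kappa>)) (snd \<kappa>)) \<and>
     (\<forall>\<kappa>\<in>\<A>. \<forall>\<mu>\<in>\<A>. smooth_on (snd \<kappa> ` (fst \<kappa> \<inter> fst \<mu>)) (transition \<kappa> \<mu>))"

text \<open>A tangent vector at \<open>p\<close> is represented by the family of its component vectors with respect
  to all charts around \<open>p\<close>; the components with respect to two charts are related by the
  differential of the transition map. The value \<open>0\<close> at charts not around \<open>p\<close> is a dummy that makes
  the representation unique.\<close>

type_synonym ('a, 'n) tangent = "('a, 'n) chart \<Rightarrow> real ^ 'n"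

definition tangent_space :: "('a, 'n::finite) chart set \<Rightarrow> 'a \<Rightarrow> ('a, 'n) tangent set" where
  "tangent_space \<A> p =
     {v. (\<forall>\<kappa>\<in>\<A>. \<forall>\<mu>\<in>\<A>. p \<in> fst \<kappa> \<and> p \<in> fst \<mu> \<longrightarrow>
             v \<mu> = frechet_derivative (transition \<kappa> \<mu>) (at (snd \<kappa> p)) (v \<kappa>)) \<and>
         (\<forall>\<kappa>. \<not> (\<kappa> \<in> \<A> \<and> p \<in> fst \<kappa>) \<longrightarrow> v \<kappa> = 0)}"

definition tangent_bundle ::
    "'a topology \<Rightarrow> ('a, 'n::finite) chart set \<Rightarrow> ('a \<times> ('a, 'n) tangent) set" where
  "tangent_bundle X \<A> = (SIGMA p:topspace X. tangent_space \<A> p)"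

text \<open>The tangent vector at \<open>p\<close> with components \<open>y\<close> in the chart \<open>\<kappa>\<close>.\<close>

definition tangent_of_components ::
    "('a, 'n::finite) chart set \<Rightarrow> ('a, 'n) chart \<Rightarrow> 'a \<Rightarrow> real ^ 'n \<Rightarrow> ('a, 'n) tangent" where
  "tangent_of_components \<A> \<kappa> p y =
     (\<lambda>\<mu>. if \<mu> \<in> \<A> \<and> p \<in> fst \<mu>
          then frechet_derivative (transition \<kappa> \<mu>) (at (snd \<kappa> p)) y else 0)"

text \<open>Expression of a function on the tangent bundle in the local coordinates
  \<open>(x\<^sup>i, y\<^sup>i)\<close> induced by the chart \<open>\<kappa>\<close>.\<close>

definition in_coords ::
    "('a, 'n::finite) chart set \<Rightarrow> ('a, 'n) chart \<Rightarrow> ('a \<times> ('a, 'n) tangent \<Rightarrow> real) \<Rightarrow>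
     real ^ 'n \<Rightarrow> real ^ 'n \<Rightarrow> real" where
  "in_coords \<A> \<kappa> F x y = F (chart_inv \<kappa> x, tangent_of_components \<A> \<kappa> (chart_inv \<kappa> x) y)"

section \<open>Local expressions of Finsler tensors\<close>

text \<open>In this section \<open>f x y\<close> stands for a Finsler metric in local coordinates.\<close>

definition dx :: "'n::finite \<Rightarrow> (real ^ 'n \<Rightarrow> real ^ 'n \<Rightarrow> real) \<Rightarrow> real ^ 'n \<Rightarrow> real ^ 'n \<Rightarrow> real" where
  "dx i h x y = deriv (\<lambda>t. h (x + t *\<^sub>R axis i 1) y) 0"

definition dy :: "'n::finite \<Rightarrow> (real ^ 'n \<Rightarrow> real ^ 'n \<Rightarrow> real) \<Rightarrow> real ^ 'n \<Rightarrow> real ^ 'n \<Rightarrow> real" where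
  "dy i h x y = deriv (\<lambda>t. h x (y + t *\<^sub>R axis i 1)) 0"

definition fundamental_tensor ::
    "(real ^ 'n::finite \<Rightarrow> real ^ 'n \<Rightarrow> real) \<Rightarrow> 'n \<Rightarrow> 'n \<Rightarrow> real ^ 'n \<Rightarrow> real ^ 'n \<Rightarrow> real" where
  "fundamental_tensor f i j x y = 1/2 * dy i (dy j (\<lambda>x y. (f x y)\<^sup>2)) x y"

definition inverse_tensor ::
    "(real ^ 'n::finite \<Rightarrow> real ^ 'n \<Rightarrow> real) \<Rightarrow> 'n \<Rightarrow> 'n \<Rightarrow> real ^ 'n \<Rightarrow> real ^ 'n \<Rightarrow> real" where
  "inverse_tensor f i j x y = matrix_inv (\<chi> k l. fundamental_tensor f k l x y) $ i $ j"

definition cartan_torsion ::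
    "(real ^ 'n::finite \<Rightarrow> real ^ 'n \<Rightarrow> real) \<Rightarrow> 'n \<Rightarrow> 'n \<Rightarrow> 'n \<Rightarrow> real ^ 'n \<Rightarrow> real ^ 'n \<Rightarrow> real" where
  "cartan_torsion f i j k x y = 1/2 * dy k (fundamental_tensor f i j) x y"

definition mean_cartan_torsion ::
    "(real ^ 'n::finite \<Rightarrow> real ^ 'n \<Rightarrow> real) \<Rightarrow> 'n \<Rightarrow> real ^ 'n \<Rightarrow> real ^ 'n \<Rightarrow> real" where
  "mean_cartan_torsion f i x y =
     (\<Sum>j\<in>UNIV. \<Sum>k\<in>UNIV. inverse_tensor f j k x y * cartan_torsion f i j k x y)"

definition spray_coefficient ::
    "(real ^ 'n::finite \<Rightarrow> real ^ 'n \<Rightarrow> real) \<Rightarrow> 'n \<Rightarrow> real ^ 'n \<Rightarrow> real ^ 'n \<Rightarrow> real" where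
  "spray_coefficient f i x y =
     1/4 * (\<Sum>l\<in>UNIV. inverse_tensor f i l x y *
       ((\<Sum>k\<in>UNIV. dx k (dy l (\<lambda>x y. (f x y)\<^sup>2)) x y * y $ k) - dx l (\<lambda>x y. (f x y)\<^sup>2) x y))"

definition landsberg_curvature ::
    "(real ^ 'n::finite \<Rightarrow> real ^ 'n \<Rightarrow> real) \<Rightarrow> 'n \<Rightarrow> 'n \<Rightarrow> 'n \<Rightarrow> real ^ 'n \<Rightarrow> real ^ 'n \<Rightarrow> real" where
  "landsberg_curvature f i j k x y =
     - 1/2 * (\<Sum>s\<in>UNIV. (\<Sum>t\<in>UNIV. fundamental_tensor f s t x y * y $ t) *
                        dy i (dy j (dy k (spray_coefficient f s))) x y)"

definition mean_landsberg_curvature ::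
    "(real ^ 'n::finite \<Rightarrow> real ^ 'n \<Rightarrow> real) \<Rightarrow> 'n \<Rightarrow> real ^ 'n \<Rightarrow> real ^ 'n \<Rightarrow> real" where
  "mean_landsberg_curvature f i x y =
     (\<Sum>j\<in>UNIV. \<Sum>k\<in>UNIV. inverse_tensor f j k x y * landsberg_curvature f i j k x y)"

section \<open>Finsler metrics\<close>

definition finsler_metric ::
    "'a topology \<Rightarrow> ('a, 'n::finite) chart set \<Rightarrow> ('a \<times> ('a, 'n) tangent \<Rightarrow> real) \<Rightarrow> bool" where
  "finsler_metric X \<A> F \<longleftrightarrow>
     (\<forall>(p, v)\<in>tangent_bundle X \<A>. 0 \<le> F (p, v)) \<and>
     (\<forall>(p, v)\<in>tangent_bundle X \<A>. \<forall>r>0. F (p, \<lambda>\<kappa>. r *\<^sub>R v \<kappa>) = r * F (p, v)) \<and>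
     (\<forall>\<kappa>\<in>\<A>. smooth_on (chart_image \<kappa> \<times> (UNIV - {0})) (\<lambda>(x, y). in_coords \<A> \<kappa> F x y)) \<and>
     (\<forall>\<kappa>\<in>\<A>. \<forall>x\<in>chart_image \<kappa>. \<forall>y. y \<noteq> 0 \<longrightarrow>
        (\<forall>u::real ^ 'n. u \<noteq> 0 \<longrightarrow>
           (\<Sum>i\<in>UNIV. \<Sum>j\<in>UNIV. fundamental_tensor (in_coords \<A> \<kappa> F) i j x y * u $ i * u $ j) > 0))"

text \<open>The coefficients \<open>a\<^bsub>i\<^sub>1\<dots>i\<^sub>m\<^esub>(x)\<close> are indexed by the lists \<open>[i\<^sub>1, \<dots>, i\<^sub>m]\<close>; symmetry means
  invariance under rearrangement of the list.\<close>

definition mth_root_metric ::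
    "('a, 'n::finite) chart set \<Rightarrow> nat \<Rightarrow> ('a \<times> ('a, 'n) tangent \<Rightarrow> real) \<Rightarrow> bool" where
  "mth_root_metric \<A> m F \<longleftrightarrow> m > 0 \<and>
     (\<forall>\<kappa>\<in>\<A>. \<exists>a :: 'n list \<Rightarrow> real ^ 'n \<Rightarrow> real.
        (\<forall>is js. length is = m \<and> mset is = mset js \<longrightarrow> a is = a js) \<and>
        (\<forall>x\<in>chart_image \<kappa>. \<forall>y. in_coords \<A> \<kappa> F x y =
           root m (\<Sum>is | length is = m. a is x * (\<Prod>i\<leftarrow>is. y $ i))))"

definition riemannian ::
    "('a, 'n::finite) chart set \<Rightarrow> ('a \<times> ('a, 'n) tangent \<Rightarrow> real) \<Rightarrow> bool" where
  "riemannian \<A> F \<longleftrightarrow>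
     (\<forall>\<kappa>\<in>\<A>. \<forall>x\<in>chart_image \<kappa>. \<forall>y. y \<noteq> 0 \<longrightarrow>
        (\<forall>i j k. cartan_torsion (in_coords \<A> \<kappa> F) i j k x y = 0))"

section \<open>Tangent vectors and components\<close>

text \<open>For a chart \<open>\<kappa>\<close> around \<open>p\<close>, the map \<open>y \<mapsto> tangent_of_components \<A> \<kappa> p y\<close> is a bijection from
  \<open>\<real>\<^sup>n\<close> onto the tangent space at \<open>p\<close>, with inverse \<open>v \<mapsto> v \<kappa>\<close>.\<close>

lemma chart_homeomorphic:
  assumes "smooth_manifold X \<A>" "\<kappa> \<in> \<A>"
  shows "openin X (fst \<kappa>)" "open (chart_image \<kappa>)"
    "homeomorphic_map (subtopology X (fst \<kappa>)) (top_of_set (chart_image \<kappa>)) (snd \<kappa>)"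
  using assms by (simp_all add: smooth_manifold_def)

lemma smooth_transition:
  assumes "smooth_manifold X \<A>" "\<kappa> \<in> \<A>" "\<mu> \<in> \<A>"
  shows "smooth_on (snd \<kappa> ` (fst \<kappa> \<inter> fst \<mu>)) (transition \<kappa> \<mu>)"
  using assms by (simp add: smooth_manifold_def)

lemma chart_inv_left:
  assumes "smooth_manifold X \<A>" "\<kappa> \<in> \<A>" "p \<in> fst \<kappa>"
  shows "chart_inv \<kappa> (snd \<kappa> p) = p"
proof -
  note h = chart_homeomorphic[OF assms(1,2)]
  have "topspace (subtopology X (fst \<kappa>)) = fst \<kappa>"
    using openin_subset[OF h(1)] by auto
  then have "inj_on (snd \<kappa>) (fst \<kappa>)"
    using h(3) by (simp add: homeomorphic_map_def)
  then show ?thesis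
    using assms(3) by (simp add: chart_inv_def)
qed

lemma overlap_open:
  assumes M: "smooth_manifold X \<A>" and "\<kappa> \<in> \<A>" "\<mu> \<in> \<A>"
  shows "open (snd \<kappa> ` (fst \<kappa> \<inter> fst \<mu>))"
proof -
  note h = chart_homeomorphic[OF M assms(2)] chart_homeomorphic(1)[OF M assms(3)]
  have "openin (subtopology X (fst \<kappa>)) (fst \<kappa> \<inter> fst \<mu>)"
    using h(4) by (metis inf_commute openin_subtopology)
  then have "openin (top_of_set (chart_image \<kappa>)) (snd \<kappa> ` (fst \<kappa> \<inter> fst \<mu>))"
    using homeomorphic_imp_open_map[OF h(3)] by (simp add: open_map_def)
  then show ?thesis
    by (rule openin_open_trans[OF _ h(2)])
qed

lemma transition_has_derivative:
  assumes "smooth_manifold X \<A>" "\<kappa> \<in> \<A>" "\<mu> \<in> \<A>" "p \<in> fst \<kappa>" "p \<in> fst \<mu>"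
  shows "(transition \<kappa> \<mu> has_derivative frechet_derivative (transition \<kappa> \<mu>) (at (snd \<kappa> p)))
           (at (snd \<kappa> p))"
proof -
  have "higher_differentiable_on (snd \<kappa> ` (fst \<kappa> \<inter> fst \<mu>)) (transition \<kappa> \<mu>) (Suc 0)"
    using smooth_transition[OF assms(1-3)] unfolding smooth_on_def by (rule spec)
  then have "transition \<kappa> \<mu> differentiable at (snd \<kappa> p)"
    using assms(4,5) unfolding higher_differentiable_on.simps by blast
  then show ?thesis
    by (simp only: frechet_derivative_works)
qed

lemma transition_derivative_compose:
  assumes M: "smooth_manifold X \<A>" and A: "\<kappa> \<in> \<A>" "\<mu> \<in> \<A>" "\<nu> \<in> \<A>"
    and p: "p \<in> fst \<kappa>" "p \<in> fst \<mu>" "p \<in> fst \<nu>"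
  shows "frechet_derivative (transition \<mu> \<nu>) (at (snd \<mu> p))
           (frechet_derivative (transition \<kappa> \<mu>) (at (snd \<kappa> p)) y) =
         frechet_derivative (transition \<kappa> \<nu>) (at (snd \<kappa> p)) y"
proof -
  let ?D\<kappa>\<mu> = "frechet_derivative (transition \<kappa> \<mu>) (at (snd \<kappa> p))"
  let ?D\<mu>\<nu> = "frechet_derivative (transition \<mu> \<nu>) (at (snd \<mu> p))"
  have "transition \<kappa> \<mu> (snd \<kappa> p) = snd \<mu> p"
    using chart_inv_left[OF M A(1) p(1)] by (simp add: transition_def)
  then have "(transition \<mu> \<nu> \<circ> transition \<kappa> \<mu> has_derivative ?D\<mu>\<nu> \<circ> ?D\<kappa>\<mu>) (at (snd \<kappa> p))"
    using diff_chain_at[OF transition_has_derivative[OF M A(1,2) p(1,2)],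
        of "transition \<mu> \<nu>" ?D\<mu>\<nu>] transition_has_derivative[OF M A(2,3) p(2,3)] by simp
  then have "(transition \<kappa> \<nu> has_derivative ?D\<mu>\<nu> \<circ> ?D\<kappa>\<mu>) (at (snd \<kappa> p))"
  proof (rule has_derivative_transform_within_open)
    show "open (snd \<kappa> ` (fst \<kappa> \<inter> fst \<mu>))"
      by (rule overlap_open[OF M A(1,2)])
    show "snd \<kappa> p \<in> snd \<kappa> ` (fst \<kappa> \<inter> fst \<mu>)"
      using p by blast
    show "(transition \<mu> \<nu> \<circ> transition \<kappa> \<mu>) x = transition \<kappa> \<nu> x"
      if "x \<in> snd \<kappa> ` (fst \<kappa> \<inter> fst \<mu>)" for x
      using that chart_inv_left[OF M A(1)] chart_inv_left[OF M A(2)]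
      by (auto simp: transition_def)
  qed
  from has_derivative_unique[OF this transition_has_derivative[OF M A(1,3) p(1,3)]]
  show ?thesis
    by (simp add: fun_eq_iff)
qed

lemma transition_derivative_self:
  assumes M: "smooth_manifold X \<A>" and A: "\<kappa> \<in> \<A>" and p: "p \<in> fst \<kappa>"
  shows "frechet_derivative (transition \<kappa> \<kappa>) (at (snd \<kappa> p)) y = y"
proof -
  have "(transition \<kappa> \<kappa> has_derivative (\<lambda>y. y)) (at (snd \<kappa> p))"
  proof (rule has_derivative_transform_within_open[OF has_derivative_ident])
    show "open (snd \<kappa> ` (fst \<kappa> \<inter> fst \<kappa>))"
      by (rule overlap_open[OF M A A])
    show "snd \<kappa> p \<in> snd \<kappa> ` (fst \<kappa> \<inter> fst \<kappa>)"
      using p by blast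
    show "x = transition \<kappa> \<kappa> x" if "x \<in> snd \<kappa> ` (fst \<kappa> \<inter> fst \<kappa>)" for x
      using that chart_inv_left[OF M A] by (auto simp: transition_def)
  qed
  from has_derivative_unique[OF this transition_has_derivative[OF M A A p p]]
  show ?thesis
    by (simp add: fun_eq_iff)
qed

lemma bij_betw_tangent_of_components:
  assumes M: "smooth_manifold X \<A>" and A: "\<kappa> \<in> \<A>" and p: "p \<in> fst \<kappa>"
  shows "tangent_of_components \<A> \<kappa> p y \<kappa> = y"
    and "bij_betw (tangent_of_components \<A> \<kappa> p) UNIV (tangent_space \<A> p)"
proof -
  show *: "tangent_of_components \<A> \<kappa> p y \<kappa> = y" for y
    using A p by (simp add: tangent_of_components_def transition_derivative_self[OF M A p])
  show "bij_betw (tangent_of_components \<A> \<kappa> p) UNIV (tangent_space \<A> p)"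
  proof (rule bij_betw_byWitness[where f' = "\<lambda>v. v \<kappa>"])
    show "\<forall>y\<in>UNIV. tangent_of_components \<A> \<kappa> p y \<kappa> = y"
      using * by blast
    show "\<forall>v\<in>tangent_space \<A> p. tangent_of_components \<A> \<kappa> p (v \<kappa>) = v"
    proof (intro ballI ext)
      fix v \<mu> assume v: "v \<in> tangent_space \<A> p"
      show "tangent_of_components \<A> \<kappa> p (v \<kappa>) \<mu> = v \<mu>"
      proof (cases "\<mu> \<in> \<A> \<and> p \<in> fst \<mu>")
        case True
        then have "v \<mu> = frechet_derivative (transition \<kappa> \<mu>) (at (snd \<kappa> p)) (v \<kappa>)"
          using v A p unfolding tangent_space_def by blast
        with True show ?thesis
          by (simp only: tangent_of_components_def simp_thms if_True)
      next
        case False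
        then have "v \<mu> = 0"
          using v unfolding tangent_space_def by blast
        with False show ?thesis
          by (simp only: tangent_of_components_def if_False)
      qed
    qed
    show "(\<lambda>v. v \<kappa>) ` tangent_space \<A> p \<subseteq> UNIV"
      by simp
    show "range (tangent_of_components \<A> \<kappa> p) \<subseteq> tangent_space \<A> p"
    proof (rule image_subsetI)
      fix y
      show "tangent_of_components \<A> \<kappa> p y \<in> tangent_space \<A> p"
        unfolding tangent_space_def tangent_of_components_def
        using transition_derivative_compose[OF M A _ _ p] by simp
    qed
  qed
qed

end

theory Submission
  imports Defs
begin

text \<open>
  The theorem is a parity argument in the fibre variable \<open>y\<close>. The form \<open>A\<close> is homogeneous of degree
  \<open>m\<close>, so \<open>A(x, -y) = \<plusminus> A(x, y)\<close> and hence \<open>F(x, -y) = \<plusminus> F(x, y)\<close>; as \<open>F\<close> is nonnegative, \<open>F\<close> is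
  reversible: \<open>F(x, -y) = F(x, y)\<close>. A derivative in a direction \<open>y\<^sup>i\<close> changes the parity in \<open>y\<close>,
  and a derivative in a direction \<open>x\<^sup>i\<close> keeps it. So \<open>g\<^sub>i\<^sub>j\<close>, \<open>g\<^sup>i\<^sup>j\<close> and \<open>G\<^sup>i\<close> are even, the Cartan
  torsion and \<open>\<^bold>I\<close> are odd, and \<open>L\<^sub>i\<^sub>j\<^sub>k\<close>, being the product of the odd \<open>y\<^sub>s\<close> with an odd third
  derivative of \<open>G\<^sup>s\<close>, is even, and so is \<open>\<^bold>J\<close>. In \<open>\<^bold>J + c F \<^bold>I = 0\<close> the first term is therefore
  even in \<open>y\<close> and the second one odd, so each of them vanishes. The converse is the case \<open>c = 0\<close>.

  The rule that a derivative changes or keeps the parity is valid only where the derivative exists,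
  because \<open>deriv\<close> is an arbitrary number elsewhere. Parity is therefore carried along together with
  smoothness, in the predicate \<open>smooth_with_parity\<close>. It is stable under all operations
  that occur in the definitions of \<open>\<^bold>I\<close> and \<open>\<^bold>J\<close>; the inverse matrix \<open>(g\<^sup>i\<^sup>j)\<close> is treated by Cramer's
  rule. The resulting parities are \<open>mean_cartan_torsion_odd\<close> and \<open>mean_landsberg_curvature_even\<close>.
\<close>

section \<open>Calculus of smooth real functions\<close>

lemma higher_differentiable_on_has_derivative:
  assumes "higher_differentiable_on S f (Suc k)" "x \<in> S"
  shows "(f has_derivative frechet_derivative f (at x)) (at x)"
proof -
  have "f differentiable (at x)"
    using assms by simp
  then show ?thesis
    by (simp only: frechet_derivative_works)
qed

lemma higher_differentiable_on_cong:
  assumes "open S" "\<And>x. x \<in> S \<Longrightarrow> f x = g x" "higher_differentiable_on S f k"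
  shows "higher_differentiable_on S g k"
  using assms(2,3)
proof (induction k arbitrary: f g)
  case 0
  then show ?case by (simp cong: continuous_on_cong)
next
  case (Suc k)
  have D: "(g has_derivative frechet_derivative f (at x)) (at x)" if "x \<in> S" for x
    by (rule has_derivative_transform_within_open[OF
          higher_differentiable_on_has_derivative[OF Suc.prems(2) that] \<open>open S\<close> that Suc.prems(1)])
  have "frechet_derivative f (at x) = frechet_derivative g (at x)" if "x \<in> S" for x
    by (rule frechet_derivative_at[OF D[OF that]])
  moreover have "higher_differentiable_on S (\<lambda>x. frechet_derivative f (at x) v) k" for v
    using Suc.prems(2) by simp
  ultimately have "higher_differentiable_on S (\<lambda>x. frechet_derivative g (at x) v) k" for v
    by (rule Suc.IH[OF fun_cong])
  moreover have "g differentiable (at x)" if "x \<in> S" for x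
    using D[OF that] by (rule differentiableI)
  ultimately show ?case
    by simp
qed

text \<open>Lets a closed form \<open>D\<close> of the derivative replace the operator \<open>frechet_derivative\<close>, so that the
  rules below follow by induction on the order.\<close>

lemma higher_differentiable_on_SucI:
  assumes "open S" and D: "\<And>x. x \<in> S \<Longrightarrow> (f has_derivative D x) (at x)"
    and k: "\<And>v. higher_differentiable_on S (\<lambda>x. D x v) k"
  shows "higher_differentiable_on S f (Suc k)"
proof -
  have "higher_differentiable_on S (\<lambda>x. frechet_derivative f (at x) v) k" for v
  proof (rule higher_differentiable_on_cong[OF \<open>open S\<close> _ k[of v]])
    show "D x v = frechet_derivative f (at x) v" if "x \<in> S" for x
      by (simp only: frechet_derivative_at[OF D[OF that]])
  qed
  moreover have "f differentiable (at x)" if "x \<in> S" for x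
    using D[OF that] by (rule differentiableI)
  ultimately show ?thesis
    by simp
qed

lemma higher_differentiable_on_SucD:
  assumes "higher_differentiable_on S f (Suc k)"
  shows "higher_differentiable_on S f k"
  using assms
proof (induction k arbitrary: f)
  case 0
  then show ?case
    by (auto intro!: continuous_at_imp_continuous_on differentiable_imp_continuous_within)
next
  case (Suc k)
  then show ?case
    unfolding higher_differentiable_on.simps(2)[of S f] by blast
qed

lemma higher_differentiable_on_const:
  "open S \<Longrightarrow> higher_differentiable_on S (\<lambda>x. c) k"
proof (induction k arbitrary: c)
  case (Suc k)
  show ?case
    using Suc by (intro higher_differentiable_on_SucI[where D = "\<lambda>x v. 0"]) auto
qed simp

lemma higher_differentiable_on_bounded_linear:
  assumes "open S" "bounded_linear f"
  shows "higher_differentiable_on S f k"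
proof (cases k)
  case 0
  then show ?thesis
    using linear_continuous_on[OF assms(2)] by simp
next
  case (Suc j)
  show ?thesis unfolding Suc
    using assms
    by (intro higher_differentiable_on_SucI[where D = "\<lambda>x. f"] higher_differentiable_on_const
        bounded_linear_imp_has_derivative)
qed

lemma higher_differentiable_on_add:
  assumes "open S" "higher_differentiable_on S f k" "higher_differentiable_on S g k"
  shows "higher_differentiable_on S (\<lambda>x. f x + g x) k"
  using assms(2,3)
proof (induction k arbitrary: f g)
  case 0
  then show ?case by (simp add: continuous_on_add)
next
  case (Suc k)
  have "(f has_derivative frechet_derivative f (at x)) (at x)"
    "(g has_derivative frechet_derivative g (at x)) (at x)" if "x \<in> S" for x
    using Suc.prems that higher_differentiable_on_has_derivative by blast+
  then show ?case
    using Suc by (intro higher_differentiable_on_SucI[OF \<open>open S\<close> has_derivative_add]) auto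
qed

lemma higher_differentiable_on_mult:
  fixes f g :: "'a::real_normed_vector \<Rightarrow> real"
  assumes "open S" "higher_differentiable_on S f k" "higher_differentiable_on S g k"
  shows "higher_differentiable_on S (\<lambda>x. f x * g x) k"
  using assms(2,3)
proof (induction k arbitrary: f g)
  case 0
  then show ?case by (simp add: continuous_on_mult)
next
  case (Suc k)
  have "(f has_derivative frechet_derivative f (at x)) (at x)"
    "(g has_derivative frechet_derivative g (at x)) (at x)" if "x \<in> S" for x
    using Suc.prems that higher_differentiable_on_has_derivative by blast+
  moreover have "higher_differentiable_on S f k" "higher_differentiable_on S g k"
    using Suc.prems higher_differentiable_on_SucD by blast+
  ultimately show ?case
    using Suc by (intro higher_differentiable_on_SucI[OF \<open>open S\<close> has_derivative_mult]
        higher_differentiable_on_add[OF \<open>open S\<close>]) auto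
qed

lemma higher_differentiable_on_inverse:
  fixes f :: "'a::real_normed_vector \<Rightarrow> real"
  assumes "open S" and nz: "\<And>x. x \<in> S \<Longrightarrow> f x \<noteq> 0" and "higher_differentiable_on S f k"
  shows "higher_differentiable_on S (\<lambda>x. inverse (f x)) k"
  using assms(3)
proof (induction k)
  case 0
  then show ?case using nz by (simp add: continuous_on_inverse)
next
  case (Suc k)
  note IH = Suc.IH[OF higher_differentiable_on_SucD[OF Suc.prems]]
  have D: "((\<lambda>x. inverse (f x)) has_derivative
      (\<lambda>v. (- 1) * (inverse (f x) * frechet_derivative f (at x) v * inverse (f x)))) (at x)"
    if "x \<in> S" for x
    using Deriv.has_derivative_inverse[OF nz[OF that] higher_differentiable_on_has_derivative[OF Suc.prems that]]
    by simp
  show ?case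
    using Suc.prems
    by (intro higher_differentiable_on_SucI[OF \<open>open S\<close> D] higher_differentiable_on_mult IH
        higher_differentiable_on_const \<open>open S\<close>) auto
qed

section \<open>Smooth functions with a parity in the fibre variable\<close>

text \<open>The parity \<open>s\<close> is \<open>1\<close> for functions that are even in \<open>y\<close> and \<open>- 1\<close> for odd ones. As a factor it
  makes the rule for products a multiplication of parities. The zero section is excluded because
  a Finsler metric is smooth only away from it.\<close>

definition smooth_with_parity ::
    "(real ^ 'n::finite) set \<Rightarrow> real \<Rightarrow> (real ^ 'n \<Rightarrow> real ^ 'n \<Rightarrow> real) \<Rightarrow> bool" where
  "smooth_with_parity U s h \<longleftrightarrow>
     smooth_on (U \<times> (UNIV - {0})) (\<lambda>(x, y). h x y) \<and>
     (\<forall>x\<in>U. \<forall>y. y \<noteq> 0 \<longrightarrow> h x (- y) = s * h x y)"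

lemma smooth_with_parityI:
  assumes "\<And>k. higher_differentiable_on (U \<times> (UNIV - {0})) (\<lambda>p. h (fst p) (snd p)) k"
    and "\<And>x y. x \<in> U \<Longrightarrow> y \<noteq> 0 \<Longrightarrow> h x (- y) = s * h x y"
  shows "smooth_with_parity U s h"
  using assms by (simp add: smooth_with_parity_def smooth_on_def case_prod_unfold)

lemma smooth_with_parity_imp_higher_differentiable_on:
  assumes "smooth_with_parity U s h"
  shows "higher_differentiable_on (U \<times> (UNIV - {0})) (\<lambda>p. h (fst p) (snd p)) k"
  using assms by (simp add: smooth_with_parity_def smooth_on_def case_prod_unfold)

lemma smooth_with_parityD:
  assumes "smooth_with_parity U s h" "x \<in> U" "y \<noteq> 0"
  shows "h x (- y) = s * h x y"
  using assms by (simp add: smooth_with_parity_def)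

lemma open_slit: "open U \<Longrightarrow> open (U \<times> (UNIV - {0 :: real ^ 'n::finite}))"
  by (intro open_Times open_Diff) auto

lemma smooth_with_parity_cong:
  assumes "open U" "\<And>x y. x \<in> U \<Longrightarrow> y \<noteq> 0 \<Longrightarrow> h x y = k x y" "smooth_with_parity U s h"
  shows "smooth_with_parity U s k"
proof (rule smooth_with_parityI)
  show "higher_differentiable_on (U \<times> (UNIV - {0})) (\<lambda>p. k (fst p) (snd p)) n" for n
    by (rule higher_differentiable_on_cong[OF open_slit[OF assms(1)] _
          smooth_with_parity_imp_higher_differentiable_on[OF assms(3)]])
      (simp add: assms(2) mem_Times_iff)
  show "k x (- y) = s * k x y" if "x \<in> U" "y \<noteq> 0" for x y
    using smooth_with_parityD[OF assms(3) that] assms(2)[OF that] assms(2)[of x "- y"] that by simp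
qed

lemma smooth_with_parity_const:
  "open U \<Longrightarrow> smooth_with_parity U 1 (\<lambda>x y. c)"
  by (rule smooth_with_parityI) (simp_all add: higher_differentiable_on_const open_slit)

lemma smooth_with_parity_component:
  fixes U :: "(real ^ 'n::finite) set"
  assumes "open U"
  shows "smooth_with_parity U (- 1) (\<lambda>x y. y $ i)"
proof (rule smooth_with_parityI)
  show "higher_differentiable_on (U \<times> (UNIV - {0})) (\<lambda>p :: (real ^ 'n) \<times> (real ^ 'n). snd p $ i) k" for k
    by (intro higher_differentiable_on_bounded_linear open_slit assms
        bounded_linear_compose[OF bounded_linear_vec_nth bounded_linear_snd])
qed simp

lemma smooth_with_parity_add:
  assumes "open U" "smooth_with_parity U s h" "smooth_with_parity U s k"
  shows "smooth_with_parity U s (\<lambda>x y. h x y + k x y)"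
  by (intro smooth_with_parityI higher_differentiable_on_add open_slit
      smooth_with_parity_imp_higher_differentiable_on[OF assms(2)]
      smooth_with_parity_imp_higher_differentiable_on[OF assms(3)] assms(1))
    (simp add: smooth_with_parityD[OF assms(2)] smooth_with_parityD[OF assms(3)] distrib_left)

lemma smooth_with_parity_mult:
  assumes "open U" "smooth_with_parity U s h" "smooth_with_parity U t k" "r = s * t"
  shows "smooth_with_parity U r (\<lambda>x y. h x y * k x y)"
  by (intro smooth_with_parityI higher_differentiable_on_mult open_slit
      smooth_with_parity_imp_higher_differentiable_on[OF assms(2)]
      smooth_with_parity_imp_higher_differentiable_on[OF assms(3)] assms(1))
    (simp add: smooth_with_parityD[OF assms(2)] smooth_with_parityD[OF assms(3)] assms(4))

lemma smooth_with_parity_cmult: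
  assumes "open U" "smooth_with_parity U s h"
  shows "smooth_with_parity U s (\<lambda>x y. c * h x y)"
  using smooth_with_parity_mult[OF assms(1) smooth_with_parity_const[OF assms(1)] assms(2)] by simp

lemma smooth_with_parity_diff:
  assumes "open U" "smooth_with_parity U s h" "smooth_with_parity U s k"
  shows "smooth_with_parity U s (\<lambda>x y. h x y - k x y)"
  using smooth_with_parity_add[OF assms(1,2) smooth_with_parity_cmult[OF assms(1,3), of "- 1"]]
  by simp

lemma smooth_with_parity_sum:
  assumes "open U" "\<And>i. i \<in> I \<Longrightarrow> smooth_with_parity U s (h i)"
  shows "smooth_with_parity U s (\<lambda>x y. \<Sum>i\<in>I. h i x y)"
proof -
  have zero: "smooth_with_parity U s (\<lambda>x y. 0)"
    using smooth_with_parity_const[OF assms(1), of 0] by (simp add: smooth_with_parity_def)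
  show ?thesis
    using assms(2)
    by (induction I rule: infinite_finite_induct)
      (simp_all add: zero smooth_with_parity_add[OF assms(1)])
qed

lemma smooth_even_prod:
  assumes "open U" "\<And>i. i \<in> I \<Longrightarrow> smooth_with_parity U 1 (h i)"
  shows "smooth_with_parity U 1 (\<lambda>x y. \<Prod>i\<in>I. h i x y)"
  using assms(2)
  by (induction I rule: infinite_finite_induct)
    (simp_all add: smooth_with_parity_const[OF assms(1)]
      smooth_with_parity_mult[OF assms(1), where s = 1 and t = 1])

lemma smooth_even_divide:
  assumes "open U" "smooth_with_parity U 1 h" "smooth_with_parity U 1 k"
    and "\<And>x y. x \<in> U \<Longrightarrow> y \<noteq> 0 \<Longrightarrow> k x y \<noteq> 0"
  shows "smooth_with_parity U 1 (\<lambda>x y. h x y / k x y)"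
proof -
  have "smooth_with_parity U 1 (\<lambda>x y. inverse (k x y))"
    by (intro smooth_with_parityI higher_differentiable_on_inverse open_slit
        smooth_with_parity_imp_higher_differentiable_on[OF assms(3)] assms(1))
      (use assms(4) smooth_with_parityD[OF assms(3)] in auto)
  from smooth_with_parity_mult[OF assms(1,2) this] show ?thesis
    by (simp add: divide_inverse)
qed

text \<open>Differentiating \<open>H \<circ> \<sigma> = s H\<close> along the linear reflection \<open>\<sigma>(x, y) = (x, -y)\<close>. A
  direction \<open>v\<close> that is horizontal or vertical is an eigenvector of \<open>\<sigma>\<close>, with eigenvalue \<open>e\<close>; this is
  where the parity is kept or changed.\<close>

lemma smooth_with_parity_directional_derivative:
  fixes U :: "(real ^ 'n::finite) set"
  assumes U: "open U" and h: "smooth_with_parity U s h"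
    and v: "(fst v, - snd v) = e *\<^sub>R v" and e: "e * e = 1"
  shows "smooth_with_parity U (e * s) (\<lambda>x y. frechet_derivative (\<lambda>(x, y). h x y) (at (x, y)) v)"
proof -
  let ?H = "\<lambda>(x, y). h x y" and ?W = "U \<times> (UNIV - {0})"
  let ?\<sigma> = "\<lambda>p :: (real ^ 'n) \<times> (real ^ 'n). (fst p, - snd p)"
  have smooth: "higher_differentiable_on ?W ?H k" for k
    using h by (simp add: smooth_with_parity_def smooth_on_def)
  note D = higher_differentiable_on_has_derivative[OF smooth]
  have "frechet_derivative ?H (at (x, - y)) v = (e * s) * frechet_derivative ?H (at (x, y)) v"
    if x: "x \<in> U" and y: "y \<noteq> 0" for x y
  proof -
    let ?p = "(x, y)" and ?q = "(x, - y)"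
    have "(?\<sigma> has_derivative ?\<sigma>) (at ?p)"
      by (auto intro!: derivative_eq_intros)
    from diff_chain_at[OF this, of ?H "frechet_derivative ?H (at ?q)"]
    have "((?H \<circ> ?\<sigma>) has_derivative frechet_derivative ?H (at ?q) \<circ> ?\<sigma>) (at ?p)"
      using D[of ?q] x y by simp
    then have "((\<lambda>p. s * ?H p) has_derivative frechet_derivative ?H (at ?q) \<circ> ?\<sigma>) (at ?p)"
      by (rule has_derivative_transform_within_open[OF _ open_slit[OF U]])
        (simp_all add: x y mem_Times_iff smooth_with_parityD[OF h] case_prod_unfold)
    moreover have "((\<lambda>p. s * ?H p) has_derivative (\<lambda>w. s * frechet_derivative ?H (at ?p) w)) (at ?p)"
      using has_derivative_mult_right[OF D[of ?p]] x y by simp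
    ultimately have "(frechet_derivative ?H (at ?q) \<circ> ?\<sigma>) v = s * frechet_derivative ?H (at ?p) v"
      using has_derivative_unique by fastforce
    then have "frechet_derivative ?H (at ?q) (e *\<^sub>R v) = s * frechet_derivative ?H (at ?p) v"
      using v by simp
    moreover have "linear (frechet_derivative ?H (at ?q))"
      using D[of ?q] x y by (intro has_derivative_linear) auto
    ultimately have "e * frechet_derivative ?H (at ?q) v = s * frechet_derivative ?H (at ?p) v"
      by (simp add: linear_scale)
    then have "(e * e) * frechet_derivative ?H (at ?q) v = e * s * frechet_derivative ?H (at ?p) v"
      by (simp add: mult.assoc)
    with e show ?thesis by simp
  qed
  moreover have "higher_differentiable_on ?W (\<lambda>p. frechet_derivative ?H (at p) v) k" for k
    using smooth[of "Suc k"] unfolding higher_differentiable_on.simps by blast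
  ultimately show ?thesis
    by (simp add: smooth_with_parity_def smooth_on_def case_prod_unfold)
qed

lemma deriv_along_line:
  assumes "(H has_derivative D) (at p)"
  shows "deriv (\<lambda>t. H (p + t *\<^sub>R v)) 0 = D v"
proof -
  have "((\<lambda>t. p + t *\<^sub>R v) has_derivative (\<lambda>t. t *\<^sub>R v)) (at 0)"
    by (auto intro!: derivative_eq_intros)
  then have "((\<lambda>t. H (p + t *\<^sub>R v)) has_derivative (\<lambda>t. D (t *\<^sub>R v))) (at 0)"
    using diff_chain_at[of "\<lambda>t. p + t *\<^sub>R v" "\<lambda>t. t *\<^sub>R v" 0 H D] assms by (simp add: o_def)
  then have "((\<lambda>t. H (p + t *\<^sub>R v)) has_real_derivative D v) (at 0)"
    using has_derivative_linear[OF assms]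
    by (simp add: has_field_derivative_def linear_scale mult_commute_abs)
  then show ?thesis
    by (rule DERIV_imp_deriv)
qed

lemma smooth_with_parity_has_derivative:
  assumes "smooth_with_parity U s h" "x \<in> U" "y \<noteq> 0"
  shows "((\<lambda>(x, y). h x y) has_derivative frechet_derivative (\<lambda>(x, y). h x y) (at (x, y))) (at (x, y))"
  using smooth_with_parity_imp_higher_differentiable_on[OF assms(1), of "Suc 0"] assms(2,3)
  unfolding case_prod_unfold
  by (intro higher_differentiable_on_has_derivative[of "U \<times> (UNIV - {0})" _ 0])
    (simp_all only: mem_Times_iff, simp)

lemma smooth_with_parity_dx:
  assumes "open U" "smooth_with_parity U s h"
  shows "smooth_with_parity U s (dx i h)"
proof (rule smooth_with_parity_cong[OF assms(1)])
  show "smooth_with_parity U s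
      (\<lambda>x y. frechet_derivative (\<lambda>(x, y). h x y) (at (x, y)) (axis i 1, 0))"
    using smooth_with_parity_directional_derivative[OF assms, of "(axis i 1, 0)" 1] by simp
  show "frechet_derivative (\<lambda>(x, y). h x y) (at (x, y)) (axis i 1, 0) = dx i h x y"
    if "x \<in> U" "y \<noteq> 0" for x y
    using deriv_along_line[OF smooth_with_parity_has_derivative[OF assms(2) that], of "(axis i 1, 0)"]
    by (simp add: dx_def)
qed

lemma smooth_with_parity_dy:
  assumes "open U" "smooth_with_parity U s h" "r = - s"
  shows "smooth_with_parity U r (dy i h)"
proof (rule smooth_with_parity_cong[OF assms(1)])
  show "smooth_with_parity U r
      (\<lambda>x y. frechet_derivative (\<lambda>(x, y). h x y) (at (x, y)) (0, axis i 1))"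
    using smooth_with_parity_directional_derivative[OF assms(1,2), of "(0, axis i 1)" "- 1"] assms(3)
    by simp
  show "frechet_derivative (\<lambda>(x, y). h x y) (at (x, y)) (0, axis i 1) = dy i h x y"
    if "x \<in> U" "y \<noteq> 0" for x y
    using deriv_along_line[OF smooth_with_parity_has_derivative[OF assms(2) that], of "(0, axis i 1)"]
    by (simp add: dy_def)
qed

section \<open>Parity of the curvature tensors of a reversible metric\<close>

text \<open>Cramer's rule, applied to the \<open>j\<close>-th column of the inverse. It expresses the entries by sums,
  products and one division, for which smoothness and parity are known.\<close>

lemma matrix_inv_entry:
  fixes A :: "real ^ 'n ^ 'n::finite"
  assumes "det A \<noteq> 0"
  shows "matrix_inv A $ i $ j = det (\<chi> k l. if l = i then axis j 1 $ k else A $ k $ l) / det A"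
proof -
  have "A ** matrix_inv A = mat 1"
    unfolding matrix_inv_def
    using assms someI_ex[of "\<lambda>B. A ** B = mat 1 \<and> B ** A = mat 1"]
    by (simp add: invertible_det_nz[symmetric] invertible_def)
  then have "A *v (matrix_inv A *v axis j 1) = axis j 1"
    by (simp add: matrix_vector_mul_assoc)
  then have "matrix_inv A *v axis j 1 =
      (\<chi> i. det (\<chi> k l. if l = i then axis j 1 $ k else A $ k $ l) / det A)"
    by (simp only: cramer[OF assms])
  moreover have "(matrix_inv A *v axis j 1) $ i = matrix_inv A $ i $ j"
    by (simp add: matrix_vector_mult_basis column_def)
  ultimately show ?thesis by simp
qed

lemma det_nonzero_if_positive_definite:
  fixes A :: "real ^ 'n ^ 'n::finite"
  assumes "\<And>u. u \<noteq> 0 \<Longrightarrow> (\<Sum>i\<in>UNIV. \<Sum>j\<in>UNIV. A $ i $ j * u $ i * u $ j) > 0"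
  shows "det A \<noteq> 0"
proof -
  have "u = 0" if "A *v u = 0" for u
  proof (rule ccontr)
    assume "u \<noteq> 0"
    have "(\<Sum>i\<in>UNIV. \<Sum>j\<in>UNIV. A $ i $ j * u $ i * u $ j) = (\<Sum>i\<in>UNIV. u $ i * (A *v u) $ i)"
      by (simp add: matrix_vector_mult_def sum_distrib_left mult_ac)
    with that assms[OF \<open>u \<noteq> 0\<close>] show False by simp
  qed
  then have "\<exists>B. B ** A = mat 1"
    by (simp add: matrix_left_invertible_ker)
  then show ?thesis
    by (metis invertible_det_nz invertible_left_inverse)
qed

lemma smooth_even_det:
  assumes "open U" "\<And>k l. smooth_with_parity U 1 (a k l)"
  shows "smooth_with_parity U 1 (\<lambda>x y. det (\<chi> k l. a k l x y))"
  unfolding det_def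
  by (auto intro!: smooth_with_parity_sum smooth_with_parity_cmult smooth_even_prod assms)

text \<open>All that the parity argument needs to know of a metric, in local coordinates over \<open>U\<close>.
  Openness of \<open>U\<close> makes the derivatives in the directions \<open>x\<^sup>i\<close> depend on points of \<open>U\<close> only, and
  positive definiteness makes \<open>(g\<^sub>i\<^sub>j)\<close> invertible.\<close>

locale reversible_metric =
  fixes U :: "(real ^ 'n::finite) set" and f :: "real ^ 'n \<Rightarrow> real ^ 'n \<Rightarrow> real"
  assumes open_U: "open U"
    and smooth_even: "smooth_with_parity U 1 f"
    and positive_definite: "x \<in> U \<Longrightarrow> y \<noteq> 0 \<Longrightarrow> u \<noteq> 0 \<Longrightarrow>
      (\<Sum>i\<in>UNIV. \<Sum>j\<in>UNIV. fundamental_tensor f i j x y * u $ i * u $ j) > 0"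
begin

lemma square_even: "smooth_with_parity U 1 (\<lambda>x y. (f x y)\<^sup>2)"
  using smooth_with_parity_mult[OF open_U smooth_even smooth_even] by (simp add: power2_eq_square)

lemma fundamental_tensor_even: "smooth_with_parity U 1 (fundamental_tensor f i j)"
proof -
  have "smooth_with_parity U (- 1) (dy j (\<lambda>x y. (f x y)\<^sup>2))"
    by (rule smooth_with_parity_dy[OF open_U square_even]) simp
  then have "smooth_with_parity U 1 (dy i (dy j (\<lambda>x y. (f x y)\<^sup>2)))"
    by (rule smooth_with_parity_dy[OF open_U]) simp
  from smooth_with_parity_cmult[OF open_U this, of "1/2"] show ?thesis
    by (simp add: fundamental_tensor_def[abs_def])
qed

lemma inverse_tensor_even: "smooth_with_parity U 1 (inverse_tensor f i j)"
proof -
  let ?g = "fundamental_tensor f"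
  let ?num = "\<lambda>x y. det (\<chi> k l. if l = i then axis j 1 $ k else ?g k l x y)"
    and ?det = "\<lambda>x y. det (\<chi> k l. ?g k l x y)"
  have nz: "?det x y \<noteq> 0" if "x \<in> U" "y \<noteq> 0" for x y
    using positive_definite[OF that] by (intro det_nonzero_if_positive_definite) simp
  have entry: "smooth_with_parity U 1 (\<lambda>x y. if l = i then axis j 1 $ k else ?g k l x y)" for k l
    using smooth_with_parity_const[OF open_U] fundamental_tensor_even[of k l] by (cases "l = i") auto
  have "smooth_with_parity U 1 (\<lambda>x y. ?num x y / ?det x y)"
    by (intro smooth_even_divide[OF open_U] smooth_even_det[OF open_U] fundamental_tensor_even entry nz)
  then show ?thesis
    by (rule smooth_with_parity_cong[OF open_U, rotated])
      (simp add: inverse_tensor_def matrix_inv_entry[OF nz] cong: if_cong)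
qed

lemma spray_coefficient_even: "smooth_with_parity U 1 (spray_coefficient f i)"
proof -
  let ?E = "\<lambda>x y. (f x y)\<^sup>2"
  have "smooth_with_parity U (- 1) (dy l ?E)" for l
    by (rule smooth_with_parity_dy[OF open_U square_even]) simp
  then have "smooth_with_parity U 1 (\<lambda>x y. dx k (dy l ?E) x y * y $ k)" for k l
    by (intro smooth_with_parity_mult[OF open_U smooth_with_parity_dx[OF open_U]
          smooth_with_parity_component[OF open_U]]) auto
  then have "smooth_with_parity U 1
      (\<lambda>x y. (\<Sum>k\<in>UNIV. dx k (dy l ?E) x y * y $ k) - dx l ?E x y)" for l
    by (intro smooth_with_parity_diff[OF open_U] smooth_with_parity_sum[OF open_U]
        smooth_with_parity_dx[OF open_U square_even])
  from smooth_with_parity_mult[OF open_U inverse_tensor_even this] show ?thesis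
    unfolding spray_coefficient_def[abs_def]
    by (intro smooth_with_parity_cmult[OF open_U] smooth_with_parity_sum[OF open_U]) simp
qed

lemma mean_cartan_torsion_odd: "smooth_with_parity U (- 1) (mean_cartan_torsion f i)"
proof -
  have "smooth_with_parity U (- 1) (cartan_torsion f i j k)" for j k
    unfolding cartan_torsion_def[abs_def]
    by (intro smooth_with_parity_cmult[OF open_U] smooth_with_parity_dy[OF open_U fundamental_tensor_even])
      simp
  from smooth_with_parity_mult[OF open_U inverse_tensor_even this] show ?thesis
    unfolding mean_cartan_torsion_def[abs_def]
    by (intro smooth_with_parity_sum[OF open_U]) simp
qed

lemma mean_landsberg_curvature_even: "smooth_with_parity U 1 (mean_landsberg_curvature f i)"
proof -
  have G: "smooth_with_parity U (- 1) (dy i (dy j (dy k (spray_coefficient f s))))" for j k s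
    by (rule smooth_with_parity_dy[OF open_U smooth_with_parity_dy[OF open_U
            smooth_with_parity_dy[OF open_U spray_coefficient_even refl] refl]]) simp
  have y: "smooth_with_parity U (- 1) (\<lambda>x y. \<Sum>t\<in>UNIV. fundamental_tensor f s t x y * y $ t)" for s
    by (intro smooth_with_parity_sum[OF open_U] smooth_with_parity_mult[OF open_U
          fundamental_tensor_even smooth_with_parity_component[OF open_U]]) simp
  have "smooth_with_parity U 1 (landsberg_curvature f i j k)" for j k
    unfolding landsberg_curvature_def[abs_def]
    by (intro smooth_with_parity_cmult[OF open_U] smooth_with_parity_sum[OF open_U]
        smooth_with_parity_mult[OF open_U y G]) simp
  from smooth_with_parity_mult[OF open_U inverse_tensor_even this] show ?thesis
    unfolding mean_landsberg_curvature_def[abs_def]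
    by (intro smooth_with_parity_sum[OF open_U]) simp
qed

text \<open>The equation at \<open>-y\<close> reads \<open>\<^bold>J - c F \<^bold>I = 0\<close> in terms of the values at \<open>y\<close>; adding the
  equation at \<open>y\<close> leaves \<open>2 \<^bold>J = 0\<close>. Here \<open>c\<close> must be the same at \<open>y\<close> and \<open>-y\<close>, which is where it
  matters that \<open>c\<close> is a function on \<open>M\<close>.\<close>

lemma mean_landsberg_curvature_eq_0:
  assumes eq: "\<And>y. y \<noteq> 0 \<Longrightarrow>
      mean_landsberg_curvature f i x y + c * f x y * mean_cartan_torsion f i x y = 0"
    and "x \<in> U" "y \<noteq> 0"
  shows "mean_landsberg_curvature f i x y = 0"
proof -
  have "mean_landsberg_curvature f i x y - c * f x y * mean_cartan_torsion f i x y = 0"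
    using eq[of "- y"] assms(2,3)
      smooth_with_parityD[OF mean_landsberg_curvature_even, of x y i]
      smooth_with_parityD[OF mean_cartan_torsion_odd, of x y i]
      smooth_with_parityD[OF smooth_even, of x y]
    by simp
  with eq[OF assms(3)] show ?thesis by simp
qed

end

section \<open>Reversibility of root metrics\<close>

lemma prod_list_components_minus:
  "(\<Prod>i\<leftarrow>is. (- y) $ i) = (- 1) ^ length is * (\<Prod>i\<leftarrow>is. (y :: real ^ 'n) $ i)"
  by (induction "is") simp_all

lemma finsler_metric_in_coords_nonneg:
  assumes M: "smooth_manifold X \<A>" and F: "finsler_metric X \<A> F"
    and A: "\<kappa> \<in> \<A>" and x: "x \<in> chart_image \<kappa>"
  shows "0 \<le> in_coords \<A> \<kappa> F x y"
proof -
  obtain p where p: "p \<in> fst \<kappa>" "x = snd \<kappa> p"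
    using x by (auto simp: chart_image_def)
  have "p \<in> topspace X"
    using openin_subset[OF chart_homeomorphic(1)[OF M A]] p by blast
  moreover have "tangent_of_components \<A> \<kappa> p y \<in> tangent_space \<A> p"
    using bij_betw_tangent_of_components(2)[OF M A p(1)] by (auto simp: bij_betw_def)
  ultimately have "(p, tangent_of_components \<A> \<kappa> p y) \<in> tangent_bundle X \<A>"
    by (simp add: tangent_bundle_def)
  then show ?thesis
    using F chart_inv_left[OF M A p(1)] p(2) by (auto simp: finsler_metric_def in_coords_def)
qed

text \<open>The \<open>m\<close>-th root is an odd function for every \<open>m\<close>, so \<open>F(x, -y) = \<plusminus> F(x, y)\<close>. For odd
  \<open>m\<close> the sign is negative, and nonnegativity of both sides gives \<open>F(x, -y) = 0 = F(x, y)\<close>.\<close>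

lemma mth_root_metric_reversible:
  assumes M: "smooth_manifold X \<A>" and F: "finsler_metric X \<A> F" and root: "mth_root_metric \<A> m F"
    and A: "\<kappa> \<in> \<A>" and x: "x \<in> chart_image \<kappa>"
  shows "in_coords \<A> \<kappa> F x (- y) = in_coords \<A> \<kappa> F x y"
proof -
  let ?f = "in_coords \<A> \<kappa> F x"
  obtain a :: "'b list \<Rightarrow> real ^ 'b \<Rightarrow> real"
    where a: "?f y = root m (\<Sum>is | length is = m. a is x * (\<Prod>i\<leftarrow>is. y $ i))" for y
    using root A x unfolding mth_root_metric_def by blast
  have "(\<Sum>is | length is = m. a is x * (\<Prod>i\<leftarrow>is. (- y) $ i)) =
      (- 1) ^ m * (\<Sum>is | length is = m. a is x * (\<Prod>i\<leftarrow>is. y $ i))"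
    by (simp del: vector_uminus_component add: prod_list_components_minus sum_distrib_left mult_ac)
  then have "?f (- y) = ?f y \<or> ?f (- y) = - ?f y"
    unfolding a by (cases "even m") (simp_all del: vector_uminus_component add: real_root_minus)
  then show ?thesis
    using finsler_metric_in_coords_nonneg[OF M F A x, of y]
      finsler_metric_in_coords_nonneg[OF M F A x, of "- y"] by auto
qed

lemma mth_root_metric_reversible_metric:
  assumes M: "smooth_manifold X \<A>" and F: "finsler_metric X \<A> F" and root: "mth_root_metric \<A> m F"
    and A: "\<kappa> \<in> \<A>"
  shows "reversible_metric (chart_image \<kappa>) (in_coords \<A> \<kappa> F)"
proof
  show "open (chart_image \<kappa>)"
    by (rule chart_homeomorphic(2)[OF M A])
  show "smooth_with_parity (chart_image \<kappa>) 1 (in_coords \<A> \<kappa> F)"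
    using F A mth_root_metric_reversible[OF M F root A]
    by (simp add: smooth_with_parity_def finsler_metric_def)
  show "(\<Sum>i\<in>UNIV. \<Sum>j\<in>UNIV. fundamental_tensor (in_coords \<A> \<kappa> F) i j x y * u $ i * u $ j) > 0"
    if "x \<in> chart_image \<kappa>" "y \<noteq> 0" "u \<noteq> 0" for x y u
    using F A that unfolding finsler_metric_def by blast
qed

theorem theorem1p2:
  fixes X :: "'a topology"
    and \<A> :: "('a, 'n::finite) chart set"
    and F :: "'a \<times> ('a, 'n) tangent \<Rightarrow> real"
    and m :: nat
  assumes "smooth_manifold X \<A>"
    and "finsler_metric X \<A> F"
    and "mth_root_metric \<A> m F"
    and "\<not> riemannian \<A> F"
  shows "(\<exists>c :: 'a \<Rightarrow> real. \<forall>\<kappa>\<in>\<A>. \<forall>x\<in>chart_image \<kappa>. \<forall>y. y \<noteq> 0 \<longrightarrow>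
            (\<forall>i. mean_landsberg_curvature (in_coords \<A> \<kappa> F) i x y
                 + c (chart_inv \<kappa> x) * in_coords \<A> \<kappa> F x y
                   * mean_cartan_torsion (in_coords \<A> \<kappa> F) i x y = 0))
         \<longleftrightarrow>
         (\<forall>\<kappa>\<in>\<A>. \<forall>x\<in>chart_image \<kappa>. \<forall>y. y \<noteq> 0 \<longrightarrow>
            (\<forall>i. mean_landsberg_curvature (in_coords \<A> \<kappa> F) i x y = 0))"
    (is "?ia \<longleftrightarrow> ?ib")
proof
  assume ?ia
  then obtain c :: "'a \<Rightarrow> real" where c: "\<And>\<kappa> x y i. \<kappa> \<in> \<A> \<Longrightarrow> x \<in> chart_image \<kappa> \<Longrightarrow> y \<noteq> 0 \<Longrightarrow>
      mean_landsberg_curvature (in_coords \<A> \<kappa> F) i x y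
        + c (chart_inv \<kappa> x) * in_coords \<A> \<kappa> F x y * mean_cartan_torsion (in_coords \<A> \<kappa> F) i x y = 0"
    by blast
  show ?ib
  proof (intro ballI allI impI)
    fix \<kappa> x i and y :: "real ^ 'n"
    assume A: "\<kappa> \<in> \<A>" and x: "x \<in> chart_image \<kappa>" and y: "y \<noteq> 0"
    interpret reversible_metric "chart_image \<kappa>" "in_coords \<A> \<kappa> F"
      by (rule mth_root_metric_reversible_metric[OF assms(1-3) A])
    show "mean_landsberg_curvature (in_coords \<A> \<kappa> F) i x y = 0"
      by (rule mean_landsberg_curvature_eq_0[OF c[OF A x] x y])
  qed
next
  assume ?ib
  then show ?ia
    by (intro exI[of _ "\<lambda>_. 0"]) simp
qed

end
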